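(* Let $n>1$ be an integer, and let $T$ be the set of odd prime factors $q$ of $n(2n-1)$ such that $2n=q^i+q^j$ for some integers $i,j\geq 0$. Then $$g(2,n) = \begin{cases} 2\prod_{q\in T} q & \text{if } n \text{ is a power of } 2,\\ \prod_{q\in T} q & \text{otherwise.}\end{cases}$$
   Context: For an integer $n>1$, $g(2,n)$ denotes the greatest common divisor of the set of binomial coefficients $\left\{\binom{2n}{2k}: 1\leq k<n\right\}$, $k$ ranging over integers. "$n$ is a power of $2$" means $n=2^i$ for some integer $i\geq 0$. An empty product equals $1$. *)

theory Defs
  imports Complex_Main "HOL-Computational_Algebra.Primes"
begin

definition g2 :: "nat \<Rightarrow> nat" where
  "g2 n = Gcd {(2 * n) choose (2 * k) | k. 1 \<le> k \<and> k < n}"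

definition T :: "nat \<Rightarrow> nat set" where
  "T n = {q. prime q \<and> odd q \<and> q dvd n * (2 * n - 1) \<and> (\<exists>i j :: nat. 2 * n = q ^ i + q ^ j)}"

end

theory Submission
  imports Defs "HOL-Computational_Algebra.Squarefree"
begin

text \<open>
  The first member of the family, \<open>2n choose 2\<close>, is positive, so \<open>g2 n > 0\<close>, and it suffices to find
  the primes dividing \<open>g2 n\<close> and to see that none of them divides it twice. Everything rests on two
  facts about a prime power \<open>p ^ a\<close> dividing \<open>N > 0\<close>: for \<open>0 < j < p ^ a\<close> the number \<open>N choose j\<close>
  is divisible by \<open>p\<close> (\<open>prime_dvd_choose_mult_prime_power\<close>), and for \<open>j < p ^ a\<close> the number
  \<open>N - 1 choose j\<close> is not (\<open>prime_not_dvd_choose_pred_mult_prime_power\<close>).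

  Let \<open>q\<close> be an odd prime and \<open>N = 2n\<close>. If \<open>N = q ^ i + q ^ j\<close>, then modulo \<open>q\<close> we have
  \<open>(1 + x) ^ N = (1 + x ^ (q ^ i)) * (1 + x ^ (q ^ j))\<close>, whose exponents strictly between \<open>0\<close> and \<open>N\<close>
  are odd, so \<open>q\<close> divides every \<open>N choose 2k\<close>. Conversely, remove from \<open>N\<close> the exact power \<open>q ^ a\<close>
  of \<open>q\<close> dividing it, and from the remainder, which is odd and hence positive, the exact power
  \<open>q ^ b\<close> dividing that. Both \<open>N choose q ^ a\<close> and \<open>N - q ^ a choose q ^ b\<close> are prime to \<open>q\<close>,
  and their product is a multiple of \<open>N choose (q ^ a + q ^ b)\<close>. The lower index is even, so if it is
  less than \<open>N\<close>, then \<open>q\<close> does not divide \<open>g2 n\<close>; thus \<open>q\<close> can divide \<open>g2 n\<close> only if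
  \<open>N = q ^ a + q ^ b\<close>. The prime \<open>2\<close> is treated with one such step instead of two: if
  \<open>2 ^ a\<close> is the exact power of \<open>2\<close> dividing \<open>N\<close>, then \<open>N choose 2 ^ a\<close> is odd, so \<open>2\<close> can divide
  \<open>g2 n\<close> only if \<open>N = 2 ^ a\<close>; in that case the first fact makes all the coefficients even.

  Finally, for each prime dividing \<open>g2 n\<close> there is a \<open>2n choose 2k\<close> that it divides exactly once.
  It comes from \<open>prime_square_not_dvd_choose\<close>, directly unless \<open>2n = q ^ j + 1\<close>; in that case
  \<open>2n\<close> is prime to \<open>q\<close>, and absorbing it passes to row \<open>q ^ j\<close>, where the lemma applies.
\<close>

section \<open>Binomial coefficients near multiples of a prime power\<close>

lemma prime_dvd_choose_mult_prime_power:
  fixes p :: nat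
  assumes "prime p" "p ^ a dvd N" "0 < j" "j < p ^ a"
  shows "p dvd (N choose j)"
proof (rule ccontr)
  assume "\<not> p dvd (N choose j)"
  then have cop: "coprime (p ^ a) (N choose j)"
    using assms(1) by (simp add: prime_imp_coprime)
  obtain i where j: "j = Suc i" using assms(3) gr0_implies_Suc by blast
  have "p ^ a dvd j * (N choose j)"
  proof (cases N)
    case 0
    then show ?thesis using j by simp
  next
    case (Suc M)
    then show ?thesis
      using assms(2) Suc_times_binomial_eq[of M i] j by (metis dvd_mult2 mult.commute)
  qed
  then have "p ^ a dvd j"
    using cop by (simp add: coprime_dvd_mult_left_iff)
  then show False using assms(3,4) by (meson dvd_imp_le not_le)
qed

text \<open>Modulo \<open>p\<close>, Pascal's rule and the previous lemma make the entries of row \<open>N - 1\<close> in the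
  columns below \<open>p ^ a\<close> alternate: each is the negative of the one before, and the first is \<open>1\<close>.\<close>

lemma prime_not_dvd_choose_pred_mult_prime_power:
  fixes p :: nat
  assumes "prime p" "p ^ a dvd N" "0 < N" "j < p ^ a"
  shows "\<not> p dvd (N - 1 choose j)"
  using assms(4)
proof (induction j)
  case 0
  then show ?case using assms(1) not_prime_unit by auto
next
  case (Suc j)
  have "p dvd (N choose Suc j)"
    using prime_dvd_choose_mult_prime_power[OF assms(1,2)] Suc.prems by simp
  moreover have "(N choose Suc j) = (N - 1 choose j) + (N - 1 choose Suc j)"
    using assms(3) by (cases N) auto
  ultimately show ?case using Suc by (metis Suc_lessD dvd_add_left_iff)
qed

text \<open>The absorption identity in the form in which a common factor \<open>d\<close> of both indices cancels.\<close>

lemma choose_absorb_cancel: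
  fixes c d r :: nat
  assumes "0 < d" "0 < c" "0 < r"
  shows "c * (d * r choose (d * c)) = r * (d * r - 1 choose (d * c - 1))"
proof -
  have "Suc (d * c - 1) * (Suc (d * r - 1) choose Suc (d * c - 1))
      = Suc (d * r - 1) * (d * r - 1 choose (d * c - 1))"
    using Suc_times_binomial_eq[of "d * r - 1" "d * c - 1"] by (simp add: mult.commute)
  then have "d * (c * (d * r choose (d * c))) = d * (r * (d * r - 1 choose (d * c - 1)))"
    using assms by (simp add: mult.assoc)
  then show ?thesis using assms(1) by simp
qed

lemma prime_not_dvd_choose_prime_power:
  fixes p :: nat
  assumes "prime p" "\<not> p dvd r"
  shows "\<not> p dvd (p ^ a * r choose p ^ a)"
proof -
  have pos: "0 < p ^ a" "0 < r"
    using assms prime_gt_0_nat by (auto intro: Nat.gr0I)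
  have "(p ^ a * r choose p ^ a) = r * (p ^ a * r - 1 choose (p ^ a - 1))"
    using choose_absorb_cancel[of "p ^ a" 1 r] pos by simp
  moreover have "\<not> p dvd (p ^ a * r - 1 choose (p ^ a - 1))"
    using prime_not_dvd_choose_pred_mult_prime_power[OF assms(1), of a "p ^ a * r"] pos by simp
  ultimately show ?thesis using assms by (simp add: prime_dvd_mult_iff)
qed

text \<open>The upper index contains one factor \<open>p\<close> more than the lower one, and by absorption this factor
  is all that \<open>p\<close> contributes.\<close>

lemma prime_square_not_dvd_choose:
  fixes p :: nat
  assumes "prime p" "\<not> p dvd r" "0 < c" "c < p"
  shows "\<not> p\<^sup>2 dvd (p ^ Suc a * r choose (p ^ a * c))"
proof
  assume sq: "p\<^sup>2 dvd (p ^ Suc a * r choose (p ^ a * c))"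
  let ?C = "p ^ Suc a * r - 1 choose (p ^ a * c - 1)"
  have pos: "0 < p ^ a" "0 < r" "0 < p"
    using assms prime_gt_0_nat by (auto intro: Nat.gr0I)
  have "c * (p ^ Suc a * r choose (p ^ a * c)) = p * (r * ?C)"
    using choose_absorb_cancel[of "p ^ a" c "p * r"] assms(3) pos by (simp add: mult_ac)
  then have "p * p dvd p * (r * ?C)"
    using sq by (metis dvd_mult power2_eq_square)
  then have "p dvd r * ?C" using pos by simp
  moreover have "p ^ a * c < p ^ Suc a" using assms(4) pos by simp
  then have "p ^ a * c - 1 < p ^ Suc a" by linarith
  then have "\<not> p dvd ?C"
    using prime_not_dvd_choose_pred_mult_prime_power[OF assms(1), of "Suc a" "p ^ Suc a * r"] pos
    by simp
  ultimately show False using assms by (simp add: prime_dvd_mult_iff)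
qed

section \<open>Odd primes dividing all the even-indexed coefficients\<close>

lemma prime_dvd_choose_sum_prime_powers:
  fixes q :: nat
  assumes "prime q" "odd q" "even m" "0 < m" "m < q ^ i + q ^ j"
  shows "q dvd (q ^ i + q ^ j choose m)"
proof -
  have "q dvd (q ^ i choose t) * (q ^ j choose (m - t))" if "t \<le> m" for t
  proof -
    \<comment> \<open>A term that survives modulo \<open>q\<close> has \<open>t\<close> in \<open>{0, q ^ i}\<close> and \<open>m - t\<close> in \<open>{0, q ^ j}\<close>; all
        four combinations are excluded by the parity and the range of \<open>m\<close>.\<close>
    have odds: "odd (q ^ i)" "odd (q ^ j)" using assms(2) by auto
    consider "0 < t" "t < q ^ i" | "q ^ i < t" | "0 < m - t" "m - t < q ^ j" | "q ^ j < m - t"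
      | "t = 0 \<or> t = q ^ i" "m - t = 0 \<or> m - t = q ^ j"
      by linarith
    then show ?thesis
    proof cases
      case 5
      then have "m = 0 \<or> m = q ^ i \<or> m = q ^ j \<or> m = q ^ i + q ^ j"
        using that by auto
      then show ?thesis using assms odds by auto
    next
      case 1
      then show ?thesis using prime_dvd_choose_mult_prime_power[OF assms(1) dvd_refl] by simp
    next
      case 3
      then show ?thesis using prime_dvd_choose_mult_prime_power[OF assms(1) dvd_refl] by simp
    qed (simp_all add: binomial_eq_0)
  qed
  then show ?thesis by (auto simp flip: vandermonde intro: dvd_sum)
qed

text \<open>One power of \<open>q\<close> is an odd lower index, so it takes two of them, split off in succession, to
  reach an even one.\<close>

lemma odd_prime_coprime_even_choose:
  fixes q :: nat
  assumes "prime q" "odd q" "even N" "0 < N" "\<nexists>i j. N = q ^ i + q ^ j"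
  obtains m where "even m" "0 < m" "m < N" "\<not> q dvd (N choose m)"
proof -
  have unit: "\<not> is_unit q" using assms(1) by auto
  obtain a r where N: "N = q ^ a * r" "\<not> q dvd r"
    using multiplicity_decompose'[of N q] unit assms(4)
    by (metis less_numeral_extra(3))
  have 1: "\<not> q dvd (N choose q ^ a)"
    using prime_not_dvd_choose_prime_power[OF assms(1) N(2)] N(1) by simp
  have le: "q ^ a \<le> N"
    using 1 by (metis binomial_eq_0 dvd_0_right not_le)
  have "odd (N - q ^ a)" using le assms by simp
  then have "N - q ^ a \<noteq> 0" by (metis even_zero)
  then obtain b s where M: "N - q ^ a = q ^ b * s" "\<not> q dvd s"
    using multiplicity_decompose'[of "N - q ^ a" q] unit by metis
  have 2: "\<not> q dvd (N - q ^ a choose q ^ b)"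
    using prime_not_dvd_choose_prime_power[OF assms(1) M(2)] M(1) by simp
  have "q ^ b \<le> N - q ^ a"
    using 2 by (metis binomial_eq_0 dvd_0_right not_le)
  then have le': "q ^ a + q ^ b \<le> N" using le by linarith
  have "(N choose (q ^ a + q ^ b)) * (q ^ a + q ^ b choose q ^ a)
      = (N choose q ^ a) * (N - q ^ a choose q ^ b)"
    using choose_mult[of "q ^ a" "q ^ a + q ^ b" N] le' by simp
  then have "\<not> q dvd (N choose (q ^ a + q ^ b))"
    using 1 2 assms(1) by (metis dvd_mult2 prime_dvd_mult_iff)
  moreover have "q ^ a + q ^ b < N" using le' assms(5) by (metis le_neq_implies_less)
  moreover have "even (q ^ a + q ^ b)" using assms(2) by simp
  moreover have "0 < q ^ a + q ^ b" using assms(1) prime_gt_0_nat by simp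
  ultimately show thesis by (intro that)
qed

lemma odd_prime_square_not_dvd_even_choose:
  fixes q :: nat
  assumes "prime q" "odd q" "1 < n" "2 * n = q ^ i + q ^ j"
  obtains k where "1 \<le> k" "k < n" "\<not> q\<^sup>2 dvd (2 * n choose (2 * k))"
  using assms(4)
proof (induction i j rule: linorder_wlog)
  case (sym i j)
  then show ?case by (simp add: add.commute)
next
  case (le i j)
  have q3: "3 \<le> q" using assms(1,2) prime_ge_2_nat[of q] by (cases "q = 2") auto
  show ?case
  proof (cases i)
    case (Suc a)
    \<comment> \<open>Both exponents are positive, so \<open>N = q ^ Suc a * r\<close> and the lower index \<open>2 * q ^ a\<close> will do.\<close>
    define r where "r = 1 + q ^ (j - i)"
    have eq: "2 * n = q ^ Suc a * r"
      using le Suc by (simp add: r_def distrib_left flip: power_add power_Suc)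
    have r: "\<not> q dvd r"
    proof (cases "j - i")
      case 0
      then show ?thesis using q3 by (auto simp: r_def dest: dvd_imp_le)
    next
      case (Suc d)
      then show ?thesis using q3 dvd_add_left_iff[of q "q * q ^ d" 1] by (simp add: r_def)
    qed
    have "1 \<le> q ^ a" using q3 by simp
    moreover have "q ^ a < n"
    proof -
      have "q ^ a * 3 \<le> q ^ a * q" using q3 by simp
      also have "\<dots> \<le> q ^ a * q * r" by (simp add: r_def)
      also have "\<dots> = 2 * n" using eq by simp
      finally show ?thesis using \<open>1 \<le> q ^ a\<close> by linarith
    qed
    moreover have "\<not> q\<^sup>2 dvd (2 * n choose (2 * q ^ a))"
      using prime_square_not_dvd_choose[OF assms(1) r, of 2 a] q3 eq by (simp add: mult.commute)
    ultimately show ?thesis using le by blast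
  next
    case 0
    then have N: "2 * n = Suc (q ^ j)" using le by simp
    with assms(3) have "j \<noteq> 0" by (intro notI) simp
    then obtain b where j: "j = Suc b" using not0_implies_Suc by blast
    \<comment> \<open>Here \<open>N\<close> is prime to \<open>q\<close>; absorbing it leaves \<open>q ^ j choose q ^ b\<close>, which \<open>q\<close> divides
        exactly once.\<close>
    have "even (Suc (q ^ b))" using assms(2) by simp
    then obtain k where k: "Suc (q ^ b) = 2 * k" by blast
    have absorb: "2 * k * (2 * n choose (2 * k)) = 2 * n * (q ^ j choose q ^ b)"
      using Suc_times_binomial_eq[of "q ^ j" "q ^ b"] N k by (simp add: mult.commute)
    have lt: "q ^ b < q ^ j" using j q3 by simp
    have "\<not> q\<^sup>2 dvd (2 * n choose (2 * k))"
    proof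
      assume "q\<^sup>2 dvd (2 * n choose (2 * k))"
      then have "q\<^sup>2 dvd 2 * n * (q ^ j choose q ^ b)"
        using absorb by (metis dvd_mult)
      moreover have "\<not> q dvd 2 * n"
        using N j q3 dvd_add_left_iff[of q "q ^ j" 1] by simp
      then have "coprime (q\<^sup>2) (2 * n)"
        using assms(1) by (simp add: prime_imp_coprime del: coprime_mult_right_iff)
      ultimately have "q\<^sup>2 dvd (q ^ j choose q ^ b)"
        by (simp add: coprime_dvd_mult_right_iff del: coprime_mult_right_iff)
      then show False
        using prime_square_not_dvd_choose[OF assms(1), of 1 1 b] q3 j by simp
    qed
    moreover have "1 \<le> k" "k < n" using k N lt by linarith+
    ultimately show ?thesis using le by blast
  qed
qed

section \<open>The greatest common divisor and its prime divisors\<close>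

lemma dvd_g2_iff: "d dvd g2 n \<longleftrightarrow> (\<forall>k. 1 \<le> k \<and> k < n \<longrightarrow> d dvd (2 * n choose (2 * k)))"
  unfolding g2_def dvd_Gcd_iff by blast

lemma g2_dvd_choose:
  assumes "1 \<le> k" "k < n"
  shows "g2 n dvd (2 * n choose (2 * k))"
  using iffD1[OF dvd_g2_iff dvd_refl] assms by auto

lemma g2_pos:
  assumes "1 < n"
  shows "0 < g2 n"
proof -
  have "g2 n dvd (2 * n choose 2)" using g2_dvd_choose[of 1 n] assms by simp
  moreover have "0 < (2 * n choose 2)" using assms by (intro zero_less_binomial) simp
  ultimately show ?thesis by (auto intro: Nat.gr0I)
qed

lemma odd_prime_dvd_g2_iff:
  assumes "prime q" "odd q" "1 < n"
  shows "q dvd g2 n \<longleftrightarrow> (\<exists>i j. 2 * n = q ^ i + q ^ j)"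
proof
  assume dvd: "q dvd g2 n"
  show "\<exists>i j. 2 * n = q ^ i + q ^ j"
  proof (rule ccontr)
    assume "\<nexists>i j. 2 * n = q ^ i + q ^ j"
    then obtain m where m: "even m" "0 < m" "m < 2 * n" "\<not> q dvd (2 * n choose m)"
      using odd_prime_coprime_even_choose[of q "2 * n"] assms by auto
    then obtain k where "m = 2 * k" by blast
    then show False using m dvd dvd_g2_iff[of q n] by auto
  qed
next
  assume "\<exists>i j. 2 * n = q ^ i + q ^ j"
  then obtain i j where ij: "2 * n = q ^ i + q ^ j" by blast
  show "q dvd g2 n"
    unfolding dvd_g2_iff
  proof (intro allI impI)
    fix k assume "1 \<le> k \<and> k < n"
    then show "q dvd (2 * n choose (2 * k))"
      using prime_dvd_choose_sum_prime_powers[OF assms(1,2), of "2 * k" i j] ij by simp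
  qed
qed

text \<open>Since \<open>n * (2 * n - 1)\<close> is \<open>2n choose 2\<close>, the divisibility demanded in the definition of
  \<open>T n\<close> follows from \<open>q\<close> dividing \<open>g2 n\<close>.\<close>

lemma mem_T_iff:
  assumes "1 < n"
  shows "q \<in> T n \<longleftrightarrow> prime q \<and> odd q \<and> q dvd g2 n"
proof -
  have "q dvd n * (2 * n - 1)" if "q dvd g2 n"
  proof -
    have "q dvd (2 * n choose 2)"
      using dvd_trans[OF that g2_dvd_choose[of 1 n]] assms by simp
    moreover have "(2 * n choose 2) = n * (2 * n - 1)"
      by (simp add: choose_two mult.assoc)
    ultimately show ?thesis by simp
  qed
  then show ?thesis using odd_prime_dvd_g2_iff[OF _ _ assms, of q] by (auto simp: T_def)
qed

lemma two_dvd_g2_iff: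
  assumes "1 < n"
  shows "2 dvd g2 n \<longleftrightarrow> (\<exists>i. n = 2 ^ i)"
proof
  assume dvd: "2 dvd g2 n"
  have "n \<noteq> 0" using assms by simp
  then obtain a r where n: "n = 2 ^ a * r" "odd r"
    using multiplicity_decompose'[of n 2] odd_one by blast
  have "odd (2 * n choose (2 * 2 ^ a))"
    using prime_not_dvd_choose_prime_power[of 2 r "Suc a"] n by (simp add: mult.assoc)
  then have "\<not> 2 ^ a < n" using dvd dvd_g2_iff[of 2 n] by auto
  moreover have "r \<noteq> 0" using n by (metis even_zero)
  then have "2 ^ a \<le> n" using n by simp
  ultimately show "\<exists>i. n = 2 ^ i" by (metis le_neq_implies_less)
next
  assume "\<exists>i. n = 2 ^ i"
  then obtain i where "2 * n = 2 ^ Suc i" by auto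
  then show "2 dvd g2 n"
    unfolding dvd_g2_iff
    using prime_dvd_choose_mult_prime_power[of 2 "Suc i" "2 * n"] by auto
qed

lemma squarefree_g2:
  assumes "1 < n"
  shows "squarefree (g2 n)"
proof -
  have "\<not> p\<^sup>2 dvd g2 n" if p: "prime p" for p
  proof
    assume sq: "p\<^sup>2 dvd g2 n"
    then have "p dvd g2 n" by (metis dvd_mult_left power2_eq_square)
    show False
    proof (cases "odd p")
      case True
      with \<open>p dvd g2 n\<close> obtain i j where "2 * n = p ^ i + p ^ j"
        using odd_prime_dvd_g2_iff[OF p True assms] by auto
      then show False
        using odd_prime_square_not_dvd_even_choose[OF p True assms] sq
        by (metis dvd_g2_iff)
    next
      case False
      then have "p = 2" using p primes_dvd_imp_eq two_is_prime_nat by blast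
      with \<open>p dvd g2 n\<close> obtain i where i: "n = 2 ^ i"
        using two_dvd_g2_iff[OF assms] by auto
      with assms obtain b where b: "i = Suc b" by (cases i) auto
      \<comment> \<open>The central coefficient is twice an odd number.\<close>
      have "\<not> 2\<^sup>2 dvd (2 * n choose (2 * 2 ^ b))"
        using prime_square_not_dvd_choose[of 2 1 1 i] i b by simp
      moreover have "1 \<le> (2::nat) ^ b" "2 ^ b < n" using i b by auto
      ultimately show False using sq \<open>p = 2\<close> dvd_g2_iff by blast
    qed
  qed
  then show ?thesis
    using g2_pos[OF assms] by (subst squarefree_factorial_semiring) auto
qed

theorem theorem3:
  fixes n :: nat
  assumes "n > 1"
  shows "g2 n = (if \<exists>i::nat. n = 2 ^ i then 2 * (\<Prod>q\<in>T n. q) else (\<Prod>q\<in>T n. q))"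
proof -
  have pf: "q \<in> prime_factors (g2 n) \<longleftrightarrow> prime q \<and> q dvd g2 n" for q
    using g2_pos[OF assms] by (auto simp: in_prime_factors_iff)
  have "T n \<subseteq> prime_factors (g2 n)" using mem_T_iff[OF assms] pf by blast
  then have fin: "finite (T n)" by (rule finite_subset) simp
  have two: "2 \<notin> T n" by (simp add: T_def)
  have even: "q = 2" if "prime q" "even q" for q :: nat
    using that primes_dvd_imp_eq two_is_prime_nat by blast
  have "prime_factors (g2 n) = (if \<exists>i. n = 2 ^ i then insert 2 (T n) else T n)"
  proof (rule set_eqI)
    fix q
    show "q \<in> prime_factors (g2 n) \<longleftrightarrow> q \<in> (if \<exists>i. n = 2 ^ i then insert 2 (T n) else T n)"
      unfolding pf two_dvd_g2_iff[OF assms, symmetric]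
      using mem_T_iff[OF assms, of q] even[of q] by (cases "q = 2") auto
  qed
  moreover have "g2 n = \<Prod>(prime_factors (g2 n))"
  proof -
    have "multiplicity p (g2 n) = 1" if "p \<in> prime_factors (g2 n)" for p
      using squarefree_g2[OF assms] g2_pos[OF assms] that squarefree_factorial_semiring'[of "g2 n"]
      by blast
    then have "(\<Prod>p\<in>prime_factors (g2 n). p ^ multiplicity p (g2 n)) = \<Prod>(prime_factors (g2 n))"
      by (intro prod.cong) simp_all
    then show ?thesis using prime_factorization_nat[OF g2_pos[OF assms]] by (rule trans[rotated])
  qed
  ultimately show ?thesis using fin two by auto
qed

end
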